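(* Fix a target label $y_c\in\mathbb{R}$, finitely many labels $y_1,\dots,y_N\in\mathbb{R}$, and weights $W_1(y_c),\dots,W_N(y_c)$ with $W_i(y_c)\ge 0$ for all $i$ and $\sum_{i=1}^N W_i(y_c)=1$. For each label $y$ let $P_y$ be a probability distribution (the real conditional distribution of the data given label $y$), and let $P_W(\cdot|y_c)=\sum_{i=1}^N W_i(y_c)P_{y_i}(\cdot)$. Let $\mathcal{F}$ be a class of real-valued functions and let $d_{\mathcal{F}}$ be the associated integral probability metric. If there exists a constant $L>0$ such that $d_{\mathcal{F}}(P_y,P_{y_c})\le L|y-y_c|$ for every label $y$, then $$d_{\mathcal{F}}\left(P_W(\cdot|y_c),P_{y_c}\right)\le L\sum_{i=1}^N W_i(y_c)\,|y_i-y_c|.$$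
   Context: All distributions $P_y$ live on a common measurable data space $\mathcal{X}$ (e.g. images), indexed by real scalar labels $y$. For a class $\mathcal{F}$ of measurable functions $f:\mathcal{X}\to\mathbb{R}$ (integrable under all the distributions involved), the integral probability metric is $$d_{\mathcal{F}}(P,Q)=\sup_{f\in\mathcal{F}}\left|\mathbb{E}_{\bm{x}\sim P}f(\bm{x})-\mathbb{E}_{\bm{x}\sim Q}f(\bm{x})\right|.$$ $P_W(\cdot|y_c)$ is called the vicinal target distribution; it is the finite mixture of the $P_{y_i}$ with the normalized vicinal weights $W_i(y_c)$. *)

theory Defs
  imports "HOL-Probability.Probability"
begin

text \<open>
  The supremum is taken in the extended nonnegative reals, so that it is also meaningful
  for classes on which the differences of expectations are unbounded. The integral is the
  Bochner integral, which is 0 for non-integrable functions: the definition is the intended one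
  only for classes of functions that are integrable with respect to both measures.
\<close>

definition ipm :: "('a \<Rightarrow> real) set \<Rightarrow> 'a measure \<Rightarrow> 'a measure \<Rightarrow> ennreal" where
  "ipm F P Q = (SUP f\<in>F. ennreal \<bar>(\<integral>x. f x \<partial>P) - (\<integral>x. f x \<partial>Q)\<bar>)"

definition vicinal_distribution ::
    "'a measure \<Rightarrow> nat \<Rightarrow> (nat \<Rightarrow> real \<Rightarrow> real) \<Rightarrow> (nat \<Rightarrow> real) \<Rightarrow> (real \<Rightarrow> 'a measure)
      \<Rightarrow> real \<Rightarrow> 'a measure" where
  "vicinal_distribution M N W y P y\<^sub>c =
    measure_of (space M) (sets M) (\<lambda>A. \<Sum>i=1..N. ennreal (W i y\<^sub>c) * emeasure (P (y i)) A)"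

lemma space_vicinal_distribution [simp]:
  "space (vicinal_distribution M N W y P y\<^sub>c) = space M"
  by (simp add: vicinal_distribution_def)

lemma sets_vicinal_distribution [simp, measurable_cong]:
  "sets (vicinal_distribution M N W y P y\<^sub>c) = sets M"
  by (simp add: vicinal_distribution_def)

lemma emeasure_vicinal_distribution:
  assumes P: "\<And>i. i \<in> {1..N} \<Longrightarrow> sets (P (y i)) = sets M" and A: "A \<in> sets M"
  shows "emeasure (vicinal_distribution M N W y P y\<^sub>c) A =
    (\<Sum>i=1..N. ennreal (W i y\<^sub>c) * emeasure (P (y i)) A)"
  unfolding vicinal_distribution_def
proof (rule emeasure_measure_of_sigma[OF sets.sigma_algebra_axioms _ _ A])
  let ?\<mu> = "\<lambda>A. \<Sum>i=1..N. ennreal (W i y\<^sub>c) * emeasure (P (y i)) A"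
  show "positive (sets M) ?\<mu>"
    by (simp add: positive_def)
  show "countably_additive (sets M) ?\<mu>"
    unfolding countably_additive_def
  proof (intro allI impI)
    fix B :: "nat \<Rightarrow> 'a set"
    assume B: "range B \<subseteq> sets M" "disjoint_family B"
    have "(\<Sum>j. ?\<mu> (B j)) = (\<Sum>i=1..N. \<Sum>j. ennreal (W i y\<^sub>c) * emeasure (P (y i)) (B j))"
      by (rule suminf_sum) simp
    also have "\<dots> = ?\<mu> (\<Union>j. B j)"
    proof (rule sum.cong[OF refl])
      fix i assume "i \<in> {1..N}"
      then have "range B \<subseteq> sets (P (y i))"
        using B(1) P by blast
      then show "(\<Sum>j. ennreal (W i y\<^sub>c) * emeasure (P (y i)) (B j)) =
          ennreal (W i y\<^sub>c) * emeasure (P (y i)) (\<Union>j. B j)"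
        using suminf_emeasure[OF _ B(2)] by simp
    qed
    finally show "(\<Sum>j. ?\<mu> (B j)) = ?\<mu> (\<Union>j. B j)" .
  qed
qed

lemma prob_space_vicinal_distribution:
  assumes P: "\<And>i. i \<in> {1..N} \<Longrightarrow> sets (P (y i)) = sets M"
    and prob: "\<And>i. i \<in> {1..N} \<Longrightarrow> prob_space (P (y i))"
    and W: "\<And>i. i \<in> {1..N} \<Longrightarrow> 0 \<le> W i y\<^sub>c" "(\<Sum>i=1..N. W i y\<^sub>c) = 1"
  shows "prob_space (vicinal_distribution M N W y P y\<^sub>c)"
proof (rule prob_spaceI)
  have eq: "emeasure (P (y i)) (space M) = 1" if "i \<in> {1..N}" for i
    using prob_space.emeasure_space_1[OF prob[OF that]] sets_eq_imp_space_eq[OF P[OF that]]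
    by simp
  have "emeasure (vicinal_distribution M N W y P y\<^sub>c) (space M) =
      (\<Sum>i=1..N. ennreal (W i y\<^sub>c) * emeasure (P (y i)) (space M))"
    using P by (intro emeasure_vicinal_distribution) auto
  also have "\<dots> = (\<Sum>i=1..N. ennreal (W i y\<^sub>c))"
    by (intro sum.cong) (simp_all add: eq)
  also have "\<dots> = ennreal (\<Sum>i=1..N. W i y\<^sub>c)"
    using W(1) by (intro sum_ennreal) auto
  finally show "emeasure (vicinal_distribution M N W y P y\<^sub>c)
      (space (vicinal_distribution M N W y P y\<^sub>c)) = 1"
    using W(2) by simp
qed

end

theory Submission
  imports Defs
begin

text \<open>Expectation is linear in the measure: under the mixture, the mean of f is the W-weighted
  average of the component means. Since the weights sum to 1, the mean under the target label is the
  same average of a constant, so the gap between the two means is the weighted average of the gaps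
  of the components. The triangle inequality and the Lipschitz bound estimate it by a quantity
  independent of f, which therefore bounds the supremum. The work lies in the linearity, because the
  mixture is given only by its values on sets. \<open>nn_integral_vicinal_distribution\<close>
  extends that formula from sets to nonnegative functions, and
  \<open>has_bochner_integral_vicinal_distribution\<close> to real integrable ones.\<close>

lemma nn_integral_vicinal_distribution:
  assumes P: "\<And>i. i \<in> {1..N} \<Longrightarrow> sets (P (y i)) = sets M"
    and f: "f \<in> borel_measurable M"
  shows "(\<integral>\<^sup>+x. f x \<partial>vicinal_distribution M N W y P y\<^sub>c) =
    (\<Sum>i=1..N. ennreal (W i y\<^sub>c) * (\<integral>\<^sup>+x. f x \<partial>P (y i)))"
proof -
  let ?V = "vicinal_distribution M N W y P y\<^sub>c"
  have meas: "g \<in> borel_measurable ?V" "\<And>i. i \<in> {1..N} \<Longrightarrow> g \<in> borel_measurable (P (y i))"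
    if "g \<in> borel_measurable M" for g :: "'a \<Rightarrow> ennreal"
    using that measurable_cong_sets[OF P refl, where N = borel]
      measurable_cong_sets[OF sets_vicinal_distribution refl, where N = borel] by auto
  have space: "space (P (y i)) = space M" if "i \<in> {1..N}" for i
    using sets_eq_imp_space_eq[OF P[OF that]] .
  from f show ?thesis
  proof (induction f rule: borel_measurable_induct)
    case (cong f g)
    have "(\<Sum>i=1..N. ennreal (W i y\<^sub>c) * integral\<^sup>N (P (y i)) f) =
        (\<Sum>i=1..N. ennreal (W i y\<^sub>c) * integral\<^sup>N (P (y i)) g)"
      using cong(3) space by (intro sum.cong refl arg_cong2[where f = "(*)"] nn_integral_cong) simp
    moreover have "integral\<^sup>N ?V f = integral\<^sup>N ?V g"
      using cong(3) by (intro nn_integral_cong) simp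
    ultimately show ?case
      using cong(4) by simp
  next
    \<comment> \<open>The only case that uses how the mixture is defined; the others propagate the
      identity through closure properties of the integral.\<close>
    case (set A)
    then have "integral\<^sup>N ?V (indicator A) = (\<Sum>i=1..N. ennreal (W i y\<^sub>c) * emeasure (P (y i)) A)"
      using emeasure_vicinal_distribution[of N P y M, OF P] by simp
    also have "\<dots> = (\<Sum>i=1..N. ennreal (W i y\<^sub>c) * integral\<^sup>N (P (y i)) (indicator A))"
      using set P by (intro sum.cong refl) simp
    finally show ?case .
  next
    case (mult u c)
    then show ?case
      using meas[OF mult(2)]
      by (simp add: nn_integral_cmult sum_distrib_left mult.left_commute)
  next
    case (add u v)
    then show ?case
      using meas[OF add(1)] meas[OF add(3)]
      by (simp add: nn_integral_add sum.distrib distrib_left)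
  next
    case (seq U)
    \<comment> \<open>Monotone convergence for an arbitrary measure \<open>K\<close>, since it is
      applied to the mixture and to each component.\<close>
    have sup: "(\<integral>\<^sup>+x. (SUP n. U n) x \<partial>K) = (SUP n. \<integral>\<^sup>+x. U n x \<partial>K)"
      if "\<And>n. U n \<in> borel_measurable K" for K
      using nn_integral_monotone_convergence_SUP[OF seq(3) that] by (simp add: image_comp)
    have "(\<integral>\<^sup>+x. (SUP n. U n) x \<partial>?V) =
        (SUP n. \<Sum>i=1..N. ennreal (W i y\<^sub>c) * (\<integral>\<^sup>+x. U n x \<partial>P (y i)))"
      unfolding sup[OF meas(1)[OF seq(1)]] seq.IH ..
    \<comment> \<open>Supremum and finite sum commute because every summand increases with
      n.\<close>
    also have "\<dots> = (\<Sum>i=1..N. SUP n. ennreal (W i y\<^sub>c) * (\<integral>\<^sup>+x. U n x \<partial>P (y i)))"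
      using seq(3)
      by (intro ennreal_SUP_sum)
        (auto simp: incseq_def le_fun_def intro!: mult_left_mono nn_integral_mono)
    also have "\<dots> = (\<Sum>i=1..N. ennreal (W i y\<^sub>c) * (\<integral>\<^sup>+x. (SUP n. U n) x \<partial>P (y i)))"
      using sup[OF meas(2)[OF seq(1)]]
      by (intro sum.cong refl) (simp add: SUP_mult_left_ennreal del: SUP_apply Sup_apply)
    finally show ?case
      unfolding seq(4) .
  qed
qed

text \<open>Both the positive and the negative part of f have finite integral under every component,
  hence under the finite mixture; subtracting gives the value. Integrability under the mixture is
  thus obtained together with the value, so the integral of f there is not the default 0.\<close>

lemma has_bochner_integral_vicinal_distribution:
  fixes f :: "'a \<Rightarrow> real"
  assumes P: "\<And>i. i \<in> {1..N} \<Longrightarrow> sets (P (y i)) = sets M"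
    and W: "\<And>i. i \<in> {1..N} \<Longrightarrow> 0 \<le> W i y\<^sub>c"
    and f: "f \<in> borel_measurable M"
    and int: "\<And>i. i \<in> {1..N} \<Longrightarrow> integrable (P (y i)) f"
  shows "has_bochner_integral (vicinal_distribution M N W y P y\<^sub>c) f
    (\<Sum>i=1..N. W i y\<^sub>c * (\<integral>x. f x \<partial>P (y i)))"
proof -
  let ?V = "vicinal_distribution M N W y P y\<^sub>c"
  have nonneg: "has_bochner_integral ?V g (\<Sum>i=1..N. W i y\<^sub>c * (\<integral>x. g x \<partial>P (y i)))"
    if g: "g \<in> borel_measurable M" "\<And>x. 0 \<le> g x"
      and ig: "\<And>i. i \<in> {1..N} \<Longrightarrow> integrable (P (y i)) g" for g :: "'a \<Rightarrow> real"
  proof (rule has_bochner_integral_nn_integral)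
    show "g \<in> borel_measurable ?V"
      using g(1) by measurable
    show "AE x in ?V. 0 \<le> g x"
      using g(2) by simp
    show "0 \<le> (\<Sum>i=1..N. W i y\<^sub>c * (\<integral>x. g x \<partial>P (y i)))"
      using W g(2) by (intro sum_nonneg mult_nonneg_nonneg integral_nonneg_AE) auto
    have "(\<integral>\<^sup>+x. ennreal (g x) \<partial>?V) =
        (\<Sum>i=1..N. ennreal (W i y\<^sub>c) * (\<integral>\<^sup>+x. ennreal (g x) \<partial>P (y i)))"
      using P g(1) by (intro nn_integral_vicinal_distribution) auto
    \<comment> \<open>Integrability makes each component integral a real number, and nonnegativity
      of both factors lets the product move inside \<open>ennreal\<close>.\<close>
    also have "\<dots> = (\<Sum>i=1..N. ennreal (W i y\<^sub>c * (\<integral>x. g x \<partial>P (y i))))"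
      using W g(2) ig
      by (intro sum.cong) (simp_all add: nn_integral_eq_integral ennreal_mult integral_nonneg_AE)
    also have "\<dots> = ennreal (\<Sum>i=1..N. W i y\<^sub>c * (\<integral>x. g x \<partial>P (y i)))"
      using W g(2) by (intro sum_ennreal mult_nonneg_nonneg integral_nonneg_AE) auto
    finally show "(\<integral>\<^sup>+x. ennreal (g x) \<partial>?V) =
        ennreal (\<Sum>i=1..N. W i y\<^sub>c * (\<integral>x. g x \<partial>P (y i)))" .
  qed
  have "has_bochner_integral ?V (\<lambda>x. max 0 (f x) - max 0 (- f x))
      ((\<Sum>i=1..N. W i y\<^sub>c * (\<integral>x. max 0 (f x) \<partial>P (y i))) -
       (\<Sum>i=1..N. W i y\<^sub>c * (\<integral>x. max 0 (- f x) \<partial>P (y i))))"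
    using f int by (intro has_bochner_integral_diff nonneg) auto
  also have "(\<lambda>x. max 0 (f x) - max 0 (- f x)) = f"
    by auto
  also have "(\<Sum>i=1..N. W i y\<^sub>c * (\<integral>x. max 0 (f x) \<partial>P (y i))) -
       (\<Sum>i=1..N. W i y\<^sub>c * (\<integral>x. max 0 (- f x) \<partial>P (y i))) =
       (\<Sum>i=1..N. W i y\<^sub>c * (\<integral>x. max 0 (f x) - max 0 (- f x) \<partial>P (y i)))"
    unfolding sum_subtractf[symmetric] using int
    by (intro sum.cong refl) (simp add: right_diff_distrib)
  also have "(\<lambda>x. max 0 (f x) - max 0 (- f x)) = f"
    by auto
  finally show ?thesis .
qed

theorem proposition1:
  fixes M :: "'a measure" and P :: "real \<Rightarrow> 'a measure"
    and F :: "('a \<Rightarrow> real) set"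
    and N :: nat and y :: "nat \<Rightarrow> real" and W :: "nat \<Rightarrow> real \<Rightarrow> real"
    and y\<^sub>c L :: real
  assumes prob: "\<And>t. prob_space (P t)"
    and sets_P: "\<And>t. sets (P t) = sets M"
    and meas: "\<And>f. f \<in> F \<Longrightarrow> f \<in> borel_measurable M"
    and integ: "\<And>f t. f \<in> F \<Longrightarrow> integrable (P t) f"
    and W_nonneg: "\<And>i. i \<in> {1..N} \<Longrightarrow> 0 \<le> W i y\<^sub>c"
    and W_sum: "(\<Sum>i=1..N. W i y\<^sub>c) = 1"
    and L_pos: "0 < L"
    and lipschitz: "\<And>t. ipm F (P t) (P y\<^sub>c) \<le> ennreal (L * \<bar>t - y\<^sub>c\<bar>)"
  shows "ipm F (vicinal_distribution M N W y P y\<^sub>c) (P y\<^sub>c)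
    \<le> ennreal (L * (\<Sum>i=1..N. W i y\<^sub>c * \<bar>y i - y\<^sub>c\<bar>))"
  unfolding ipm_def
proof (rule SUP_least)
  fix f assume f: "f \<in> F"
  let ?V = "vicinal_distribution M N W y P y\<^sub>c" and ?E = "\<lambda>t. \<integral>x. f x \<partial>P t"
  \<comment> \<open>The supremum bound, read for the single function f. As L is positive, the right
    side is nonnegative, so \<open>ennreal\<close> does not clip it and the inequality descends to
    the reals.\<close>
  have lip: "\<bar>?E t - ?E y\<^sub>c\<bar> \<le> L * \<bar>t - y\<^sub>c\<bar>" for t
  proof -
    have "ennreal \<bar>?E t - ?E y\<^sub>c\<bar> \<le> ipm F (P t) (P y\<^sub>c)"
      unfolding ipm_def using f by (rule SUP_upper)
    from order_trans[OF this lipschitz] show ?thesis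
      using L_pos by (simp add: ennreal_le_iff)
  qed
  have "(\<integral>x. f x \<partial>?V) = (\<Sum>i=1..N. W i y\<^sub>c * ?E (y i))"
    using sets_P W_nonneg meas[OF f] integ[OF f]
    by (intro has_bochner_integral_integral_eq has_bochner_integral_vicinal_distribution)
  \<comment> \<open>Here the normalization enters: \<open>?E y\<^sub>c\<close> is its own weighted
    average and can be absorbed into the sum.\<close>
  then have "(\<integral>x. f x \<partial>?V) - ?E y\<^sub>c = (\<Sum>i=1..N. W i y\<^sub>c * (?E (y i) - ?E y\<^sub>c))"
    using W_sum by (simp add: right_diff_distrib sum_subtractf flip: sum_distrib_right)
  also have "\<bar>\<dots>\<bar> \<le> (\<Sum>i=1..N. \<bar>W i y\<^sub>c * (?E (y i) - ?E y\<^sub>c)\<bar>)"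
    by (rule sum_abs)
  also have "\<dots> \<le> (\<Sum>i=1..N. W i y\<^sub>c * (L * \<bar>y i - y\<^sub>c\<bar>))"
    using W_nonneg lip by (intro sum_mono) (simp add: abs_mult mult_left_mono)
  also have "\<dots> = L * (\<Sum>i=1..N. W i y\<^sub>c * \<bar>y i - y\<^sub>c\<bar>)"
    by (simp add: sum_distrib_left mult.left_commute)
  finally show "ennreal \<bar>(\<integral>x. f x \<partial>?V) - ?E y\<^sub>c\<bar> \<le>
      ennreal (L * (\<Sum>i=1..N. W i y\<^sub>c * \<bar>y i - y\<^sub>c\<bar>))"
    by (rule ennreal_leI)
qed

end
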